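(* Let $G$ be a graph of even order $n \geq 6$ with degree sequence $4, 2, 2, \ldots, 2$ (that is, one vertex of degree $4$ and all other $n-1$ vertices of degree $2$). Then $G$ is not super edge-magic.
   Context: All graphs are finite, without loops or multiple edges. A graph $G$ is super edge-magic if there exists a bijective function $f:V(G) \cup E(G)\rightarrow \{1, 2, \ldots , |V(G)| + |E(G)|\}$ such that $f(V(G)) =\{1, 2, \ldots , |V(G)|\}$ and $f(u) + f(v) + f(uv)$ is the same constant for every edge $uv\in E(G)$. *)

theory Defs
  imports Main "HOL-Library.Multiset"
begin

locale simple_graph =
  fixes V :: "'a set" and E :: "'a set set"
  assumes finite_vertices: "finite V"
    and edges: "e \<in> E \<Longrightarrow> e \<subseteq> V \<and> card e = 2"

definition degree :: "'a set set \<Rightarrow> 'a \<Rightarrow> nat" where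
  "degree E v = card {e \<in> E. v \<in> e}"

text \<open>Degrees of all vertices, with multiplicity, in nonincreasing order.\<close>

definition degree_sequence :: "'a set \<Rightarrow> 'a set set \<Rightarrow> nat list" where
  "degree_sequence V E = rev (sorted_list_of_multiset (image_mset (degree E) (mset_set V)))"

text \<open>
  A labelling of vertices and edges is a function on the disjoint union \<^term>\<open>V <+> E\<close>:
  \<^term>\<open>f (Inl v)\<close> is the label of the vertex \<^term>\<open>v\<close> and \<^term>\<open>f (Inr e)\<close> that of the
  edge \<^term>\<open>e\<close>.
\<close>

definition super_edge_magic :: "'a set \<Rightarrow> 'a set set \<Rightarrow> bool" where
  "super_edge_magic V E \<longleftrightarrow>
     (\<exists>f :: 'a + 'a set \<Rightarrow> nat.
        bij_betw f (V <+> E) {1..card V + card E} \<and>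
        f ` Inl ` V = {1..card V} \<and>
        (\<exists>k. \<forall>u v. {u, v} \<in> E \<longrightarrow> f (Inl u) + f (Inl v) + f (Inr {u, v}) = k))"

end

theory Submission
  imports Defs
begin

text \<open>
  Sum the magic constant over all edges. There are \<open>n + 1\<close> edges, so the total is a multiple
  of \<open>n + 1\<close>. The edge labels are \<open>n + 1, \<dots>, 2 n + 1\<close>, with sum \<open>(n + 1) (3 n + 2) / 2\<close>, and the
  vertex labels contribute \<open>n (n + 1) + 2 x\<close>, where \<open>x\<close> is the label of the vertex of degree 4.
  Since \<open>n\<close> is even, \<open>n + 1\<close> is odd and divides \<open>2 x\<close>, contradicting \<open>1 \<le> x \<le> n\<close>.
\<close>

context simple_graph
begin

lemma finite_edges: "finite E"
  using finite_vertices edges by (intro finite_subset[of E "Pow V"]) auto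

text \<open>Double counting of incidences: \<open>g v\<close> is counted once for each edge through
  \<open>v\<close>. The constant weight 1 yields the handshake lemma, and the vertex labels yield
  their share of the magic total.\<close>

lemma sum_edges_sum_vertices:
  fixes g :: "'a \<Rightarrow> nat"
  shows "(\<Sum>e\<in>E. \<Sum>v\<in>e. g v) = (\<Sum>v\<in>V. degree E v * g v)"
proof -
  have "(\<Sum>e\<in>E. \<Sum>v\<in>e. g v) = (\<Sum>e\<in>E. \<Sum>v | v \<in> V \<and> v \<in> e. g v)"
    using edges by (intro sum.cong) auto
  also have "\<dots> = (\<Sum>v\<in>V. \<Sum>e | e \<in> E \<and> v \<in> e. g v)"
    by (rule sum.swap_restrict[OF finite_edges finite_vertices])
  also have "\<dots> = (\<Sum>v\<in>V. degree E v * g v)"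
    by (simp add: degree_def)
  finally show ?thesis .
qed

lemma sum_degrees: "(\<Sum>v\<in>V. degree E v) = 2 * card E"
  using sum_edges_sum_vertices[of "\<lambda>_. 1"] edges by simp

text \<open>Sorting and reversing keep the multiset of degrees, so deleting a vertex of degree
  \<open>d\<close> removes one copy of \<open>d\<close> and leaves only copies of \<open>c\<close>.
  This also covers \<open>d = c\<close>.\<close>

lemma degree_sequence_ConsE:
  assumes "degree_sequence V E = d # replicate m c"
  obtains w where "w \<in> V" "degree E w = d" "\<And>v. v \<in> V - {w} \<Longrightarrow> degree E v = c"
proof -
  let ?M = "\<lambda>A. image_mset (degree E) (mset_set A)"
  have "?M V = mset (degree_sequence V E)"
    by (simp add: degree_sequence_def)
  then have eq: "?M V = add_mset d (replicate_mset m c)"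
    using assms by simp
  then have "d \<in># ?M V"
    by simp
  then obtain w where w: "w \<in> V" "degree E w = d"
    using finite_vertices by auto
  then have "?M V = add_mset d (?M (V - {w}))"
    using finite_vertices by (simp add: mset_set.remove)
  with eq have "?M (V - {w}) = replicate_mset m c"
    by simp
  then have "degree E ` (V - {w}) \<subseteq> {c}"
    using finite_vertices
    by (metis finite_Diff finite_set_mset_mset_set in_replicate_mset set_image_mset singletonI subsetI)
  with w show thesis
    by (intro that) auto
qed

text \<open>Summing the magic condition over all edges eliminates the individual edge labels: as a
  set they are known, hence so is their sum.\<close>

lemma super_edge_magicE:
  assumes "super_edge_magic V E"
  obtains g :: "'a \<Rightarrow> nat" and k where
    "bij_betw g V {1..card V}"
    "(\<Sum>v\<in>V. degree E v * g v) + (\<Sum>i = card V + 1..card V + card E. i) = k * card E"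
proof -
  obtain f :: "'a + 'a set \<Rightarrow> nat" and k where
    f: "bij_betw f (V <+> E) {1..card V + card E}" "f ` Inl ` V = {1..card V}"
    and k: "\<And>u v. {u, v} \<in> E \<Longrightarrow> f (Inl u) + f (Inl v) + f (Inr {u, v}) = k"
    using assms unfolding super_edge_magic_def by blast
  have inj: "inj_on f (V <+> E)"
    using f(1) by (rule bij_betw_imp_inj_on)
  have g: "bij_betw (\<lambda>v. f (Inl v)) V {1..card V}"
    using inj f(2) unfolding bij_betw_def inj_on_def by auto
  have injE: "inj_on (\<lambda>e. f (Inr e)) E"
    using inj unfolding inj_on_def by auto
  \<comment> \<open>By injectivity the edges receive exactly the labels left over by the
    vertices.\<close>
  have "f ` Inr ` E = f ` ((V <+> E) - Inl ` V)"
    by (rule arg_cong[of _ _ "image f"]) auto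
  also have "\<dots> = f ` (V <+> E) - f ` Inl ` V"
    using inj by (intro inj_on_image_set_diff) auto
  also have "\<dots> = {card V + 1..card V + card E}"
    using f by (auto simp: bij_betw_def)
  finally have labels: "(\<lambda>e. f (Inr e)) ` E = {card V + 1..card V + card E}"
    by (simp add: image_image)
  have "(\<Sum>v\<in>e. f (Inl v)) + f (Inr e) = k" if e: "e \<in> E" for e
  proof -
    \<comment> \<open>Distinctness makes the sum over \<open>e\<close> have two terms.\<close>
    obtain u v where "e = {u, v}" "u \<noteq> v"
      using edges[OF e] by (auto simp: card_2_iff)
    with k[of u v] e show ?thesis
      by simp
  qed
  then have "(\<Sum>e\<in>E. (\<Sum>v\<in>e. f (Inl v)) + f (Inr e)) = k * card E"
    by simp
  then have "(\<Sum>v\<in>V. degree E v * f (Inl v)) + (\<Sum>e\<in>E. f (Inr e)) = k * card E"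
    by (simp add: sum.distrib sum_edges_sum_vertices)
  moreover have "(\<Sum>e\<in>E. f (Inr e)) = (\<Sum>i = card V + 1..card V + card E. i)"
    using sum.reindex[OF injE, of "\<lambda>i. i"] labels by (simp add: o_def)
  ultimately show thesis
    using g that by metis
qed

end

text \<open>These are the edge labels for \<open>n = 2 * m\<close>: an odd number
  \<open>2 * m + 1\<close> of consecutive integers, with the integer mean \<open>3 * m + 1\<close>.
  Hence their number divides their sum.\<close>

lemma sum_upper_labels:
  "(\<Sum>i = 2 * m + 1..2 * m + (2 * m + 1). i) = (2 * m + 1) * (3 * m + 1)" for m :: nat
proof -
  have "2 * (\<Sum>i = 2 * m + 1..2 * m + (2 * m + 1). i) = 2 * ((2 * m + 1) * (3 * m + 1))"
    by (subst Sum_Icc_nat) (simp add: algebra_simps)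
  then show ?thesis
    by simp
qed

theorem theorem2p1:
  fixes V :: "'a set" and E :: "'a set set" and n :: nat
  assumes "simple_graph V E"
    and "card V = n"
    and "even n"
    and "n \<ge> 6"
    and "degree_sequence V E = 4 # replicate (n - 1) 2"
  shows "\<not> super_edge_magic V E"
proof
  assume magic: "super_edge_magic V E"
  interpret simple_graph V E by fact
  obtain w where w: "w \<in> V" "degree E w = 4" "\<And>v. v \<in> V - {w} \<Longrightarrow> degree E v = 2"
    using degree_sequence_ConsE[OF assms(5)] by blast
  \<comment> \<open>Every vertex has weight 2, and \<open>w\<close> has an excess of 2. Taking
    \<open>h\<close> constantly 1 counts the edges; taking \<open>h = g\<close> isolates the label
    of \<open>w\<close>.\<close>
  have weighted: "(\<Sum>v\<in>V. degree E v * h v) = 2 * (\<Sum>v\<in>V. h v) + 2 * h w" for h :: "'a \<Rightarrow> nat"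
    using w by (simp add: sum.remove[OF finite_vertices w(1)] sum_distrib_left)
  have card_E: "card E = n + 1"
    using weighted[of "\<lambda>_. 1"] sum_degrees assms(2) by simp
  obtain m where m: "n = 2 * m"
    using assms(3) by blast
  obtain g k where g: "bij_betw g V {1..card V}"
    and total: "(\<Sum>v\<in>V. degree E v * g v) + (\<Sum>i = card V + 1..card V + card E. i) = k * card E"
    using super_edge_magicE[OF magic] by blast
  have "2 * (\<Sum>v\<in>V. g v) = n * (n + 1)"
    using sum.reindex_bij_betw[OF g, of "\<lambda>i. i"] assms(2,3) Sum_Icc_nat[of 1 n] by simp
  with total have "(n * (n + 1) + (n + 1) * (3 * m + 1)) + 2 * g w = k * (n + 1)"
    using sum_upper_labels[of m] by (simp add: weighted card_E assms(2) m)
  moreover have "n + 1 dvd n * (n + 1) + (n + 1) * (3 * m + 1)"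
    by (intro dvd_add dvd_triv_left dvd_triv_right)
  ultimately have "n + 1 dvd 2 * g w"
    by (metis dvd_add_right_iff dvd_triv_right)
  moreover have "coprime (n + 1) 2"
    using assms(3) by simp
  ultimately have "n + 1 dvd g w"
    using coprime_dvd_mult_right_iff by blast
  moreover have "g w \<in> {1..n}"
    using bij_betwE[OF g] w(1) assms(2) by blast
  \<comment> \<open>A positive multiple of \<open>n + 1\<close> cannot be at most
    \<open>n\<close>.\<close>
  ultimately show False
    by (auto dest: dvd_imp_le)
qed

end
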